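(* For every $\alpha\in\mathbb C$, with $A=\alpha^2$, one has the identity of formal power series in $t$ $$\Psi_A(t)=\frac{e^{t}\bigl(\cosh 2\alpha t-\cosh t\bigr)}{\sinh 2t}=\tfrac12\Bigl(\frac1{\sinh t}+\frac1{\cosh t}\Bigr)\bigl(\cosh 2\alpha t-\cosh t\bigr).$$ Equivalently, coefficientwise, for every $n\ge1$, $$L_n^{\mathrm{diag}}=\frac{4^n}{n(n+1)}\Bigl[B_{n+1}\bigl(\tfrac{3+2\alpha}4\bigr)+B_{n+1}\bigl(\tfrac{3-2\alpha}4\bigr)-B_{n+1}(1)-B_{n+1}\bigl(\tfrac12\bigr)\Bigr],$$ where $B_k(x)$ are the Bernoulli polynomials (convention $B_1=-\frac12$).
   Context: For $\nu\in\mathbb C$ and $k\ge0$ let $a_k(\nu)=\dfrac{(\frac12+\nu)_k(\frac12-\nu)_k}{(-2)^k k!}=\dfrac{\prod_{j=0}^{k-1}(4\nu^2-(2j+1)^2)}{8^k k!}$ (Hankel coefficients; $(x)_k$ is the Pochhammer symbol). Let $p=1+i$, $q=1-i$. For parameters $\alpha,\beta$ put $G_n=\sum_{l=0}^n a_l(\alpha)a_{n-l}(\beta)p^lq^{n-l}$ and $$F(Z)=\sum_{n\ge0}\frac{G_n}{(Z-1)(Z-2)\cdots(Z-n)},$$ regarded as a formal power series in $Z^{-1}$ (each summand is expanded at $Z=\infty$, where it is $O(Z^{-n})$); its constant term is $1$. Write $\log F=\sum_{n\ge1}L_nZ^{-n}$. Let $L_n^{\mathrm{diag}}$ be the value of $L_n$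 on the diagonal $\beta=\alpha$ (it depends only on $A=\alpha^2$), and set $$\Psi_A(t)=\sum_{n\ge1}\frac{L_n^{\mathrm{diag}}}{(n-1)!}t^n .$$ *)

theory Defs
  imports
    "HOL-Analysis.Analysis"
    "HOL-Computational_Algebra.Computational_Algebra"
begin

unbundle fps_syntax

definition hankel_coeff :: "nat \<Rightarrow> complex \<Rightarrow> complex" where
  "hankel_coeff k \<nu> = pochhammer (1/2 + \<nu>) k * pochhammer (1/2 - \<nu>) k / ((-2) ^ k * fact k)"

definition G_coeff :: "complex \<Rightarrow> complex \<Rightarrow> nat \<Rightarrow> complex" where
  "G_coeff \<alpha> \<beta> n =
     (\<Sum>l\<le>n. hankel_coeff l \<alpha> * hankel_coeff (n - l) \<beta> * (1 + \<i>) ^ l * (1 - \<i>) ^ (n - l))"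

text \<open>
  The expansion of \<open>1 / ((Z - 1) (Z - 2) \<dots> (Z - n))\<close> at \<open>Z = \<infinity>\<close>. The indeterminate \<^const>\<open>fps_X\<close>
  stands for \<open>Z\<^sup>-\<^sup>1\<close>, and \<open>1 / (Z - j) = X / (1 - j X)\<close>.
\<close>
definition inv_falling :: "nat \<Rightarrow> complex fps" where
  "inv_falling n = fps_X ^ n * inverse (\<Prod>j=1..n. 1 - of_nat j * fps_X)"

text \<open>The infinite sum converges in the \<open>X\<close>-adic topology of \<^typ>\<open>complex fps\<close>.\<close>
definition F_series :: "complex \<Rightarrow> complex \<Rightarrow> complex fps" where
  "F_series \<alpha> \<beta> = (\<Sum>n. fps_const (G_coeff \<alpha> \<beta> n) * inv_falling n)"

text \<open>
  \<^term>\<open>fps_ln 1\<close> is the series \<open>log (1 + X)\<close>, so its composition with \<open>f - 1\<close> is \<open>log f\<close>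
  for \<open>f\<close> with constant term 1.
\<close>
definition fps_log :: "complex fps \<Rightarrow> complex fps" where
  "fps_log f = fps_compose (fps_ln 1) (f - 1)"

definition L_coeff :: "complex \<Rightarrow> complex \<Rightarrow> nat \<Rightarrow> complex" where
  "L_coeff \<alpha> \<beta> n = fps_nth (fps_log (F_series \<alpha> \<beta>)) n"

text \<open>
  The diagonal value as a function of \<open>A = \<alpha>\<^sup>2\<close>. The choice of the square root is immaterial,
  see \<open>L_diag_square\<close> below.
\<close>
definition L_diag :: "complex \<Rightarrow> nat \<Rightarrow> complex" where
  "L_diag A n = L_coeff (csqrt A) (csqrt A) n"

definition Psi :: "complex \<Rightarrow> complex fps" where
  "Psi A = Abs_fps (\<lambda>n. if n = 0 then 0 else L_diag A n / fact (n - 1))"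

text \<open>
  \<open>e\<^sup>c\<^sup>t\<close>, \<open>cosh (c t)\<close> and \<open>sinh (c t)\<close> in the field of formal Laurent series in \<open>t\<close>, where
  division by \<open>sinh (c t)\<close>, \<open>c \<noteq> 0\<close>, makes sense.
\<close>
definition fls_exp :: "complex \<Rightarrow> complex fls" where
  "fls_exp c = fps_to_fls (fps_exp c)"

definition fls_cosh :: "complex \<Rightarrow> complex fls" where
  "fls_cosh c = (fls_exp c + fls_exp (- c)) / 2"

definition fls_sinh :: "complex \<Rightarrow> complex fls" where
  "fls_sinh c = (fls_exp c - fls_exp (- c)) / 2"

text \<open>Bernoulli polynomials: \<open>t e\<^sup>x\<^sup>t / (e\<^sup>t - 1) = (\<Sum>n. B\<^sub>n(x) t\<^sup>n / n!)\<close>, hence \<open>B\<^sub>1(0) = -1/2\<close>.\<close>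
definition bernoulli_poly :: "nat \<Rightarrow> complex \<Rightarrow> complex" where
  "bernoulli_poly n x = fact n * fps_nth (fps_X * fps_exp x / (fps_exp 1 - 1)) n"

lemma hankel_coeff_altdef:
  "hankel_coeff k \<nu> = (\<Prod>j<k. 4 * \<nu>\<^sup>2 - (2 * of_nat j + 1)\<^sup>2) / (8 ^ k * fact k)"
proof (induction k)
  case (Suc k)
  have "hankel_coeff (Suc k) \<nu> =
          hankel_coeff k \<nu> * ((1/2 + \<nu> + of_nat k) * (1/2 - \<nu> + of_nat k) / (-2 * of_nat (Suc k)))"
    by (simp add: hankel_coeff_def pochhammer_Suc divide_simps del: of_nat_Suc)
  also have "(1/2 + \<nu> + of_nat k) * (1/2 - \<nu> + of_nat k) / (-2 * of_nat (Suc k)) =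
               (4 * \<nu>\<^sup>2 - (2 * of_nat k + 1)\<^sup>2) / (8 * of_nat (Suc k))"
    by (simp add: divide_simps del: of_nat_Suc) (simp add: algebra_simps power2_eq_square)
  finally show ?case
    by (simp add: Suc.IH)
qed (simp add: hankel_coeff_def)

lemma hankel_coeff_minus [simp]: "hankel_coeff k (- \<nu>) = hankel_coeff k \<nu>"
  by (simp add: hankel_coeff_altdef)

lemma L_coeff_minus: "L_coeff (- \<alpha>) (- \<beta>) n = L_coeff \<alpha> \<beta> n"
  by (simp add: L_coeff_def F_series_def G_coeff_def)

lemma L_diag_square: "L_diag (\<alpha>\<^sup>2) n = L_coeff \<alpha> \<alpha> n"
proof -
  have "csqrt (\<alpha>\<^sup>2) = \<alpha> \<or> csqrt (\<alpha>\<^sup>2) = - \<alpha>"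
    by (metis power2_csqrt power2_eq_iff)
  then show ?thesis
    by (auto simp: L_diag_def L_coeff_minus)
qed

lemma fps_to_fls_prod: "fps_to_fls (prod f A) = (\<Prod>x\<in>A. fps_to_fls (f x :: complex fps))"
  by (induction A rule: infinite_finite_induct) (simp_all add: fls_times_fps_to_fls)

lemma inv_falling_eq:
  "fps_to_fls (inv_falling n) = 1 / (\<Prod>j=1..n. inverse fls_X - of_nat j)"
proof -
  have "inverse fls_X - of_nat j = fps_to_fls (1 - of_nat j * fps_X :: complex fps) / fls_X" for j :: nat
  proof -
    have field_eq: "inverse x - c = (1 - c * x) / x" if "x \<noteq> 0" for x c :: "complex fls"
      using that by (simp add: field_simps)
    have "fps_to_fls (1 - of_nat j * fps_X :: complex fps) = 1 - of_nat j * fls_X"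
      by (simp add: fls_times_fps_to_fls fps_to_fls_of_nat)
    then show ?thesis
      by (simp only: field_eq[OF fls_X_nonzero])
  qed
  then have "(\<Prod>j=1..n. inverse fls_X - of_nat j :: complex fls) =
        (\<Prod>j=1..n. fps_to_fls (1 - of_nat j * fps_X) / fls_X)"
    by (intro prod.cong) simp_all
  also have "\<dots> = fps_to_fls (\<Prod>j=1..n. 1 - of_nat j * fps_X) / fls_X ^ n"
    by (simp only: prod_dividef fps_to_fls_prod prod_constant card_atLeastAtMost
          Suc_eq_plus1 add_diff_cancel_right')
  finally have *: "(\<Prod>j=1..n. inverse fls_X - of_nat j :: complex fls) =
    fps_to_fls (\<Prod>j=1..n. 1 - of_nat j * fps_X) / fls_X ^ n" .
  define P :: "complex fps" where "P = (\<Prod>j=1..n. 1 - of_nat j * fps_X)"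
  have "fps_nth P 0 = 1"
    unfolding P_def by (induction n) simp_all
  then have "subdegree P = 0"
    by (intro subdegreeI) auto
  then have "fps_to_fls (fps_X ^ n * inverse P) = fls_X ^ n * inverse (fps_to_fls P)"
    by (simp add: fls_times_fps_to_fls fps_to_fls_power fls_inverse_fps_to_fls)
  also have "\<dots> = 1 / (fps_to_fls P / fls_X ^ n)"
    by (simp only: divide_inverse inverse_mult_distrib inverse_inverse_eq mult_1 mult.commute)
  finally show ?thesis
    unfolding * inv_falling_def P_def .
qed

lemma F_series_sums: "(\<lambda>n. fps_const (G_coeff \<alpha> \<beta> n) * inv_falling n) sums F_series \<alpha> \<beta>"
  and F_series_nth:
    "fps_nth (F_series \<alpha> \<beta>) m = (\<Sum>n\<le>m. G_coeff \<alpha> \<beta> n * fps_nth (inv_falling n) m)"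
  and F_series_nth_0: "fps_nth (F_series \<alpha> \<beta>) 0 = 1"
proof -
  let ?t = "\<lambda>n. fps_const (G_coeff \<alpha> \<beta> n) * inv_falling n"
  let ?S = "Abs_fps (\<lambda>m. \<Sum>n\<le>m. G_coeff \<alpha> \<beta> n * fps_nth (inv_falling n) m)"
  have z: "fps_nth (inv_falling n) m = 0" if "m < n" for n m
    using that by (simp add: inv_falling_def fps_X_power_mult_nth)
  have "?t sums ?S"
    unfolding sums_def tendsto_fps_iff
  proof (intro allI)
    fix m
    show "\<forall>\<^sub>F N in sequentially. fps_nth (\<Sum>n<N. ?t n) m = fps_nth ?S m"
      using eventually_gt_at_top[of m]
    proof eventually_elim
      case (elim N)
      have "fps_nth (\<Sum>n<N. ?t n) m = (\<Sum>n<N. G_coeff \<alpha> \<beta> n * fps_nth (inv_falling n) m)"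
        by (simp add: fps_sum_nth)
      also have "\<dots> = (\<Sum>n\<le>m. G_coeff \<alpha> \<beta> n * fps_nth (inv_falling n) m)"
        using elim z by (intro sum.mono_neutral_right) auto
      finally show ?case by simp
    qed
  qed
  then have eq: "F_series \<alpha> \<beta> = ?S" and "?t sums F_series \<alpha> \<beta>"
    by (auto simp: F_series_def sums_iff)
  then show "?t sums F_series \<alpha> \<beta>" by simp
  show nth: "fps_nth (F_series \<alpha> \<beta>) m = (\<Sum>n\<le>m. G_coeff \<alpha> \<beta> n * fps_nth (inv_falling n) m)" for m
    by (simp add: eq)
  show "fps_nth (F_series \<alpha> \<beta>) 0 = 1"
    by (simp add: nth G_coeff_def hankel_coeff_def inv_falling_def)
qed

lemma bernoulli_poly_0 [simp]: "bernoulli_poly 0 x = 1"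
  and bernoulli_poly_1: "bernoulli_poly 1 x = x - 1/2"
proof -
  define Q :: "complex fps" where "Q = fps_X * fps_exp x / (fps_exp 1 - 1)"
  define E :: "complex fps" where "E = fps_exp 1 - 1"
  have E: "subdegree E = 1"
    by (rule subdegreeI) (auto simp: E_def)
  have "E dvd fps_X * fps_exp x"
    by (subst fps_dvd_iff) (use E in auto)
  then have Q: "fps_X * fps_exp x = Q * E"
    by (simp add: Q_def E_def)
  have 0: "fps_nth Q 0 = 1"
    using arg_cong[OF Q, of "\<lambda>f. fps_nth f 1"] by (simp add: fps_mult_nth E_def)
  have 1: "fps_nth Q 1 = x - 1/2"
    using arg_cong[OF Q, of "\<lambda>f. fps_nth f 2"] 0
    by (simp add: fps_mult_nth E_def numeral_2_eq_2)
  show "bernoulli_poly 0 x = 1" "bernoulli_poly 1 x = x - 1/2"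
    using 0 1 by (simp_all add: bernoulli_poly_def Q_def)
qed

end

theory Submission
  imports Defs
begin

text \<open>
  The Hankel coefficients are those of the asymptotic expansion of the Bessel function \<open>K\<^sub>\<nu>\<close>, and
  \<open>1 / ((Z - 1) \<dots> (Z - n)) = \<Gamma>(Z - n) / \<Gamma>(Z)\<close>. So \<open>\<Gamma>(Z) F(Z)\<close> is, formally and up to a constant, the
  Mellin transform \<open>\<integral> z\<^sup>Z K\<^sub>\<alpha>(z / p) K\<^sub>\<alpha>(z / q) dz\<close>; the exponential \<open>e\<^sup>-\<^sup>z\<close> in the integral for
  \<open>\<Gamma>(Z - n)\<close> is present because \<open>1 / p + 1 / q = 1\<close>. A product of two solutions of Bessel's equation
  satisfies a fourth order equation, and since \<open>p\<^sup>2 + q\<^sup>2 = 0\<close> this equation is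
  \<open>(\<theta> - 2) \<theta> (\<theta>\<^sup>2 - 4 \<alpha>\<^sup>2) u = z\<^sup>4 u\<close> with \<open>\<theta> = z d/dz\<close>.
  Its Mellin transform has only two terms, so \<open>F\<close> satisfies a first order difference equation,
  \<open>(Z - 2) (Z - 4) F(Z) = ((Z - 3)\<^sup>2 - 4 \<alpha>\<^sup>2) F(Z - 4)\<close>,
  which is \<open>F_series_shift_equation\<close>.

  All this can be carried out formally. On inverse factorial series \<open>\<Phi>(h) = \<Sum>\<^sub>n h\<^sub>n / ((Z - 1) \<dots> (Z - n))\<close>,
  multiplication by \<open>Z\<close> is a first order differential operator on the generating function
  (\<open>inverse_factorial_series_euler\<close>), and multiplication of \<open>h\<close> by \<open>X\<^sup>4\<close> is the shift from \<open>Z\<close> to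
  \<open>Z - 4\<close> with a factor \<open>1 / ((Z - 1) \<dots> (Z - 4))\<close> (\<open>inverse_factorial_series_shift\<close>). The
  fourth order equation is derived for power series in \<open>hankel_product_recurrence\<close>.

  The logarithm of the difference equation is additive. The Borel transform, which sends \<open>L\<close> to
  \<open>\<Psi>\<close>, turns \<open>Z \<mapsto> Z - 4\<close> into multiplication by \<open>e\<^bsup>4t\<^esup>\<close> and \<open>log (1 - c / Z)\<close> into \<open>1 - e\<^bsup>ct\<^esup>\<close>. Therefore
  \<open>\<Psi>(t) (e\<^bsup>4t\<^esup> - 1) = e\<^bsup>(3 + 2\<alpha>)t\<^esup> + e\<^bsup>(3 - 2\<alpha>)t\<^esup> - e\<^bsup>2t\<^esup> - e\<^bsup>4t\<^esup>\<close>
  (\<open>borel_fps_log_F_series\<close>). Division by \<open>e\<^bsup>4t\<^esup> - 1 = 2 e\<^bsup>2t\<^esup> sinh 2t\<close> gives the closed forms, and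
  comparison with the generating function of the Bernoulli polynomials gives the coefficients.
\<close>

section \<open>Inverse factorial series\<close>

text \<open>
  \<open>\<Sum>\<^sub>n h\<^sub>n / ((Z - 1) \<dots> (Z - n))\<close> with \<open>X = 1 / Z\<close>. The sum for the \<open>m\<close>-th coefficient may stop at \<open>m\<close>
  because \<^term>\<open>inv_falling n\<close> has order \<open>n\<close>.
\<close>
definition inverse_factorial_series :: "complex fps \<Rightarrow> complex fps" where
  "inverse_factorial_series h =
     Abs_fps (\<lambda>m. \<Sum>n\<le>m. fps_nth h n * fps_nth (inv_falling n) m)"

lemma inv_falling_0 [simp]: "inv_falling 0 = 1"
  by (simp add: inv_falling_def)

lemma inv_falling_nth_less: "m < n \<Longrightarrow> fps_nth (inv_falling n) m = 0"
  by (simp add: inv_falling_def fps_X_power_mult_nth)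

lemma inv_falling_mult_prod:
  "inv_falling n * (\<Prod>j=1..n. 1 - of_nat j * fps_X) = fps_X ^ n"
proof -
  have "fps_nth (\<Prod>j=1..n. 1 - of_nat j * fps_X :: complex fps) 0 = 1"
    by (induction n) simp_all
  then show ?thesis
    by (simp add: inv_falling_def mult.assoc inverse_mult_eq_1)
qed

lemma prod_one_minus_nonzero: "(\<Prod>j=1..n. 1 - of_nat j * fps_X :: complex fps) \<noteq> 0"
proof -
  have "fps_nth (\<Prod>j=1..n. 1 - of_nat j * fps_X :: complex fps) 0 = 1"
    by (induction n) simp_all
  then show ?thesis by (metis fps_zero_nth zero_neq_one)
qed

lemma inv_falling_Suc:
  "(1 - of_nat (Suc n) * fps_X) * inv_falling (Suc n) = fps_X * inv_falling n"
proof -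
  let ?P = "\<Prod>j=1..n. 1 - of_nat j * fps_X :: complex fps"
  have "((1 - of_nat (Suc n) * fps_X) * inv_falling (Suc n)) * ?P
      = inv_falling (Suc n) * (\<Prod>j=1..Suc n. 1 - of_nat j * fps_X)"
    by (simp add: mult_ac)
  also have "\<dots> = fps_X * inv_falling n * ?P"
    by (simp only: inv_falling_mult_prod mult.assoc power_Suc)
  finally show ?thesis
    using prod_one_minus_nonzero[of n] by (simp only: mult_cancel_right) blast
qed

lemma inv_falling_Suc_nth:
  "fps_nth (inv_falling (Suc n)) (Suc m) =
     fps_nth (inv_falling n) m + of_nat (Suc n) * fps_nth (inv_falling (Suc n)) m"
proof -
  have "fps_nth ((1 - of_nat (Suc n) * fps_X) * inv_falling (Suc n)) (Suc m) =
        fps_nth (fps_X * inv_falling n) (Suc m)"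
    by (simp only: inv_falling_Suc)
  then show ?thesis
    by (simp add: left_diff_distrib mult.assoc fps_mult_of_nat_nth algebra_simps del: of_nat_Suc)
qed

text \<open>
  Write \<open>e\<^sub>n = 1 / ((Z - 1) \<dots> (Z - n))\<close>. Then \<open>Z e\<^sub>n = e\<^bsub>n-1\<^esub> + n e\<^sub>n\<close>, so multiplication by \<open>Z\<close> is the
  operator \<open>T h = h / X + X h'\<close> on generating functions, at least if \<open>h\<close> has no constant term. The
  hypothesis below says \<open>k = (T - c) h\<close>, multiplied by \<open>X\<close> to stay within power series, and it
  forces the constant term of \<open>h\<close> to vanish. The conclusion is \<open>(Z - c) \<Phi>(h) = \<Phi>(k)\<close>, also
  multiplied by \<open>X\<close>.
\<close>
lemma inverse_factorial_series_euler:
  assumes "fps_X * k = h + fps_X\<^sup>2 * fps_deriv h - fps_const c * fps_X * h"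
  shows "(1 - fps_const c * fps_X) * inverse_factorial_series h =
           fps_X * inverse_factorial_series k"
proof (rule fps_ext)
  fix N
  let ?E = "\<lambda>n m. fps_nth (inv_falling n) m"
  have h0: "fps_nth h 0 = 0"
    using arg_cong[OF assms, of "\<lambda>f. fps_nth f 0"] by (simp add: power2_eq_square mult.assoc)
  have k: "fps_nth k n = fps_nth h (Suc n) + (of_nat n - c) * fps_nth h n" for n
    using arg_cong[OF assms, of "\<lambda>f. fps_nth f (Suc n)"]
    by (cases n) (simp_all add: power2_eq_square mult.assoc algebra_simps)
  show "fps_nth ((1 - fps_const c * fps_X) * inverse_factorial_series h) N =
        fps_nth (fps_X * inverse_factorial_series k) N"
  proof (cases N)
    case 0
    then show ?thesis by (simp add: inverse_factorial_series_def h0)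
  next
    case (Suc m)
    have "(\<Sum>n\<le>Suc m. fps_nth h n * ?E n (Suc m)) =
          (\<Sum>n\<le>m. fps_nth h (Suc n) * ?E (Suc n) (Suc m))"
      by (subst sum.atMost_Suc_shift) (simp add: h0)
    also have "\<dots> = (\<Sum>n\<le>m. fps_nth h (Suc n) * ?E n m) +
                     (\<Sum>n\<le>m. of_nat (Suc n) * fps_nth h (Suc n) * ?E (Suc n) m)"
      by (simp add: inv_falling_Suc_nth sum.distrib algebra_simps del: of_nat_Suc)
    also have "(\<Sum>n\<le>m. of_nat (Suc n) * fps_nth h (Suc n) * ?E (Suc n) m) =
               (\<Sum>n\<le>Suc m. of_nat n * fps_nth h n * ?E n m)"
      by (subst sum.atMost_Suc_shift) simp
    also have "\<dots> = (\<Sum>n\<le>m. of_nat n * fps_nth h n * ?E n m)"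
      by (simp add: inv_falling_nth_less)
    finally have "(\<Sum>n\<le>Suc m. fps_nth h n * ?E n (Suc m)) - c * (\<Sum>n\<le>m. fps_nth h n * ?E n m)
        = (\<Sum>n\<le>m. fps_nth k n * ?E n m)"
      by (simp add: k sum.distrib sum_subtractf sum_distrib_left algebra_simps)
    then show ?thesis
      by (simp add: Suc inverse_factorial_series_def left_diff_distrib mult.assoc)
  qed
qed

section \<open>Shifting the argument by an integer\<close>

text \<open>
  \<open>1 / (Z - r)\<close> expressed through \<open>X = 1 / Z\<close>; substituting it for \<open>X\<close> replaces \<open>Z\<close> by \<open>Z - r\<close>.
\<close>
definition shift_arg :: "nat \<Rightarrow> complex fps" where
  "shift_arg r = fps_X * inverse (1 - of_nat r * fps_X)"

lemma shift_arg_nth_0 [simp]: "fps_nth (shift_arg r) 0 = 0"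
  by (simp add: shift_arg_def)

lemma shift_arg_mult: "(1 - of_nat r * fps_X) * shift_arg r = fps_X"
proof -
  have "inverse (1 - of_nat r * fps_X) * (1 - of_nat r * fps_X :: complex fps) = 1"
    by (rule inverse_mult_eq_1) simp
  then show ?thesis
    by (simp add: shift_arg_def mult_ac)
qed

lemma fps_of_nat_compose: "fps_compose (of_nat n) (s :: complex fps) = of_nat n"
  by (simp add: fps_of_nat [symmetric])

text \<open>
  The first \<open>r\<close> factors of \<open>(Z - 1) \<dots> (Z - n - r)\<close> split off, and the others are
  \<open>(Z - r - 1) \<dots> (Z - r - n)\<close>.
\<close>
lemma inv_falling_shift:
  "inv_falling (n + r) * (\<Prod>j=1..r. 1 - of_nat j * fps_X) =
     fps_X ^ r * fps_compose (inv_falling n) (shift_arg r)"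
proof (induction n)
  case 0
  then show ?case using inv_falling_mult_prod[of r] by simp
next
  case (Suc n)
  let ?P = "\<Prod>j=1..r. 1 - of_nat j * fps_X :: complex fps"
  let ?l = "1 - of_nat (Suc n + r) * fps_X :: complex fps"
  let ?s = "shift_arg r" 
  let ?I = "\<lambda>n. fps_compose (inv_falling n) ?s"
  have "fps_compose ((1 - of_nat (Suc n) * fps_X) * inv_falling (Suc n)) ?s =
        fps_compose (fps_X * inv_falling n) ?s"
    by (simp only: inv_falling_Suc)
  then have c: "(1 - of_nat (Suc n) * ?s) * ?I (Suc n) = ?s * ?I n"
    by (simp add: fps_compose_mult_distrib fps_compose_sub_distrib fps_of_nat_compose del: of_nat_Suc)
  have "(1 - of_nat r * fps_X) * ((1 - of_nat (Suc n) * ?s) * ?I (Suc n)) =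
        ((1 - of_nat r * fps_X) * ?s) * ?I n"
    by (simp only: c mult.assoc)
  also have "(1 - of_nat r * fps_X) * ((1 - of_nat (Suc n) * ?s) * ?I (Suc n)) =
      ((1 - of_nat r * fps_X) - of_nat (Suc n) * ((1 - of_nat r * fps_X) * ?s)) * ?I (Suc n)"
    by (simp add: algebra_simps)
  finally have I: "?l * ?I (Suc n) = fps_X * ?I n"
    unfolding shift_arg_mult by (simp only: of_nat_add) (simp add: algebra_simps)
  have "?l * (inv_falling (Suc n + r) * ?P) = fps_X * (inv_falling (n + r) * ?P)"
    using inv_falling_Suc[of "n + r"] by (simp add: mult.assoc [symmetric] del: of_nat_Suc)
  also have "\<dots> = fps_X ^ r * (fps_X * ?I n)"
    unfolding Suc.IH by (simp only: mult.left_commute)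
  also have "\<dots> = ?l * (fps_X ^ r * ?I (Suc n))"
    by (simp add: I [symmetric] mult_ac)
  finally have e: "?l * (inv_falling (Suc n + r) * ?P) = ?l * (fps_X ^ r * ?I (Suc n))" .
  have "fps_nth ?l 0 \<noteq> 0" by simp
  then have "?l \<noteq> 0" by (metis fps_zero_nth)
  with e show ?case by (simp only: mult_cancel_left) blast
qed

text \<open>
  The preceding factorization, summed over \<open>n\<close>. Each coefficient involves finitely many terms only,
  so the infinite series are replaced by their truncations \<open>T\<close> and \<open>T'\<close>, for which composition and
  multiplication distribute over the sum.
\<close>
lemma inverse_factorial_series_shift:
  "inverse_factorial_series (fps_X ^ r * k) * (\<Prod>j=1..r. 1 - of_nat j * fps_X) =
     fps_X ^ r * fps_compose (inverse_factorial_series k) (shift_arg r)"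
proof (rule fps_ext)
  fix m
  let ?P = "\<Prod>j=1..r. 1 - of_nat j * fps_X :: complex fps"
  let ?s = "shift_arg r"
  define T where "T = (\<Sum>n\<le>m. fps_const (fps_nth k n) * inv_falling n)"
  define T' where "T' = (\<Sum>n\<le>m. fps_const (fps_nth k n) * inv_falling (n + r))"
  have TT': "T' * ?P = fps_X ^ r * fps_compose T ?s"
    unfolding T_def T'_def fps_compose_sum_distrib sum_distrib_left sum_distrib_right
    by (intro sum.cong)
       (simp_all add: fps_compose_mult_distrib mult.assoc inv_falling_shift[unfolded One_nat_def]
         mult.left_commute[of _ "fps_const _"])
  have T: "fps_nth (inverse_factorial_series k) j = fps_nth T j" if "j \<le> m" for j
  proof -
    have "fps_nth T j = (\<Sum>n\<le>m. fps_nth k n * fps_nth (inv_falling n) j)"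
      by (simp add: T_def fps_sum_nth)
    also have "\<dots> = (\<Sum>n\<le>j. fps_nth k n * fps_nth (inv_falling n) j)"
      using that by (intro sum.mono_neutral_right) (auto simp: inv_falling_nth_less)
    finally show ?thesis by (simp add: inverse_factorial_series_def)
  qed
  have T': "fps_nth (inverse_factorial_series (fps_X ^ r * k)) j = fps_nth T' j" if "j \<le> m" for j
  proof -
    have "fps_nth T' j = (\<Sum>n\<le>m. fps_nth k n * fps_nth (inv_falling (n + r)) j)"
      by (simp add: T'_def fps_sum_nth)
    also have "\<dots> = (\<Sum>n\<in>{r..m + r}. fps_nth k (n - r) * fps_nth (inv_falling n) j)"
      by (intro sum.reindex_bij_witness[of _ "\<lambda>n. n - r" "\<lambda>n. n + r"]) auto
    also have "\<dots> = (\<Sum>n\<le>m + r. fps_nth (fps_X ^ r * k) n * fps_nth (inv_falling n) j)"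
      by (intro sum.mono_neutral_cong_left) (auto simp: fps_X_power_mult_nth)
    also have "\<dots> = (\<Sum>n\<le>j. fps_nth (fps_X ^ r * k) n * fps_nth (inv_falling n) j)"
      using that by (intro sum.mono_neutral_right) (auto simp: inv_falling_nth_less)
    finally show ?thesis by (simp add: inverse_factorial_series_def)
  qed
  have "fps_nth (inverse_factorial_series (fps_X ^ r * k) * ?P) m = fps_nth (T' * ?P) m"
    by (simp add: fps_mult_nth T')
  also have "\<dots> = fps_nth (fps_X ^ r * fps_compose T ?s) m"
    by (simp only: TT')
  also have "\<dots> = fps_nth (fps_X ^ r * fps_compose (inverse_factorial_series k) ?s) m"
    by (simp add: fps_X_power_mult_nth fps_compose_nth T)
  finally show "fps_nth (inverse_factorial_series (fps_X ^ r * k) * ?P) m =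
    fps_nth (fps_X ^ r * fps_compose (inverse_factorial_series k) ?s) m" .
qed

section \<open>The differential equation of the Hankel series\<close>

definition hankel_fps :: "complex \<Rightarrow> complex \<Rightarrow> complex fps" where
  "hankel_fps \<nu> p = Abs_fps (\<lambda>k. hankel_coeff k \<nu> * p ^ k)"

lemma F_series_eq:
  "F_series \<alpha> \<beta> = inverse_factorial_series (hankel_fps \<alpha> (1 + \<i>) * hankel_fps \<beta> (1 - \<i>))"
  by (rule fps_ext)
     (simp add: F_series_nth inverse_factorial_series_def G_coeff_def hankel_fps_def fps_mult_nth
       atLeast0AtMost mult_ac)

lemma hankel_coeff_Suc:
  "2 * of_nat (Suc k) * hankel_coeff (Suc k) \<nu> = - (((of_nat k + 1/2)\<^sup>2 - \<nu>\<^sup>2) * hankel_coeff k \<nu>)"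
proof -
  have "hankel_coeff (Suc k) \<nu> =
          hankel_coeff k \<nu> * ((1/2 + \<nu> + of_nat k) * (1/2 - \<nu> + of_nat k) / (-2 * of_nat (Suc k)))"
    by (simp add: hankel_coeff_def pochhammer_Suc divide_simps del: of_nat_Suc)
  then show ?thesis
    by (simp del: of_nat_Suc) (simp add: algebra_simps power2_eq_square)
qed

text \<open>
  This is the modified Bessel equation for \<open>K\<^sub>\<nu>(a z)\<close>, \<open>z = 1 / X\<close>, after the factor
  \<open>z\<^bsup>-1/2\<^esup> exp (- a z)\<close> of the asymptotic expansion has been removed.
\<close>
lemma hankel_fps_ode:
  assumes "a * p = 1"
  shows "fps_X\<^sup>2 * fps_deriv (fps_deriv (hankel_fps \<nu> p)) =
    - (2 * (fps_X + fps_const a) * fps_deriv (hankel_fps \<nu> p))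
    - fps_const (1/4 - \<nu>\<^sup>2) * hankel_fps \<nu> p"
proof -
  let ?f = "hankel_fps \<nu> p"
  have X2: "fps_nth (fps_X\<^sup>2 * fps_deriv (fps_deriv ?f)) k = of_nat k * (of_nat k - 1) * fps_nth ?f k" for k
    by (cases k; cases "k - 1") (auto simp: power2_eq_square mult.assoc)
  have X1: "fps_nth (fps_X * fps_deriv ?f) k = of_nat k * fps_nth ?f k" for k
    by (cases k) auto
  have "2 * a * (of_nat (Suc k) * fps_nth ?f (Suc k)) = - (((of_nat k + 1/2)\<^sup>2 - \<nu>\<^sup>2) * fps_nth ?f k)" for k
  proof -
    have "2 * a * (of_nat (Suc k) * fps_nth ?f (Suc k)) =
          (2 * of_nat (Suc k) * hankel_coeff (Suc k) \<nu>) * (a * p) * p ^ k"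
      by (simp add: hankel_fps_def mult_ac)
    then show ?thesis
      unfolding hankel_coeff_Suc assms by (simp add: hankel_fps_def)
  qed
  note rec = this
  show ?thesis
  proof (rule fps_ext)
    fix k
    have "fps_nth (2 * (fps_X + fps_const a) * fps_deriv ?f) k =
      2 * of_nat k * fps_nth ?f k + 2 * a * (of_nat (Suc k) * fps_nth ?f (Suc k))"
    proof -
      have "2 * (fps_X + fps_const a) * fps_deriv ?f =
         fps_const 2 * (fps_X * fps_deriv ?f) + fps_const (2 * a) * fps_deriv ?f"
        by (simp add: algebra_simps numeral_fps_const flip: fps_const_mult)
      then show ?thesis
        by (simp add: X1 del: of_nat_Suc)
    qed
    then show "fps_nth (fps_X\<^sup>2 * fps_deriv (fps_deriv ?f)) k =
      fps_nth (- (2 * (fps_X + fps_const a) * fps_deriv ?f) - fps_const (1/4 - \<nu>\<^sup>2) * ?f) k"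
      unfolding rec by (simp add: X2) (simp add: algebra_simps power2_eq_square)
  qed
qed

section \<open>The formal logarithm\<close>

lemma fps_log_deriv:
  assumes "fps_nth f 0 = 1"
  shows "fps_deriv (fps_log f) * f = fps_deriv f" "fps_nth (fps_log f) 0 = 0"
proof -
  have i: "fps_compose (inverse (1 + fps_X)) (f - 1) = inverse f"
    using assms by (subst fps_inverse_compose) (simp_all add: fps_compose_add_distrib)
  have "fps_deriv (fps_log f) = inverse f * fps_deriv f"
    unfolding fps_log_def using assms
    by (subst fps_compose_deriv) (simp_all add: fps_ln_deriv i)
  then show "fps_deriv (fps_log f) * f = fps_deriv f"
    using assms by (simp add: mult_ac inverse_mult_eq_1 inverse_mult_eq_1')
  show "fps_nth (fps_log f) 0 = 0"
    by (simp add: fps_log_def fps_ln_def)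
qed

text \<open>
  All properties of the logarithm follow from its being the only series without constant term
  whose derivative is the logarithmic derivative of \<open>f\<close>.
\<close>
lemma fps_log_unique:
  assumes "fps_nth f 0 = 1" "fps_nth l 0 = 0" "fps_deriv l * f = fps_deriv f"
  shows "fps_log f = l"
proof -
  have "f \<noteq> 0" using assms(1) by auto
  then have "fps_deriv (fps_log f) = fps_deriv l"
    using fps_log_deriv(1)[OF assms(1)] assms(3) by (metis mult_cancel_right)
  then show ?thesis
    using fps_log_deriv(2)[OF assms(1)] assms(2) by (simp add: fps_deriv_eq_iff)
qed

lemma fps_log_mult:
  assumes "fps_nth f 0 = 1" "fps_nth g 0 = 1"
  shows "fps_log (f * g) = fps_log f + fps_log g"
proof (rule fps_log_unique)
  show "fps_deriv (fps_log f + fps_log g) * (f * g) = fps_deriv (f * g)"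
    using fps_log_deriv(1)[OF assms(1)] fps_log_deriv(1)[OF assms(2)]
    by (simp add: algebra_simps)
qed (use assms in \<open>auto simp: fps_log_deriv\<close>)

lemma fps_log_compose:
  assumes "fps_nth f 0 = 1" "fps_nth s 0 = 0"
  shows "fps_log (fps_compose f s) = fps_compose (fps_log f) s"
proof -
  have "fps_compose f s - 1 = fps_compose (f - 1) s"
    by (simp add: fps_compose_sub_distrib)
  then show ?thesis
    using assms by (simp add: fps_log_def fps_compose_assoc)
qed

lemma fps_log_linear:
  "fps_log (1 - fps_const c * fps_X) = Abs_fps (\<lambda>n. - (c ^ n / of_nat n))"
proof (rule fps_log_unique)
  have "fps_deriv (Abs_fps (\<lambda>n. - (c ^ n / of_nat n))) = - fps_const c * Abs_fps (\<lambda>n. c ^ n)"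
    by (rule fps_ext) (simp del: of_nat_Suc)
  also have "Abs_fps (\<lambda>n. c ^ n) * (1 - fps_const c * fps_X) = 1"
    by (rule fps_ext) (auto simp: algebra_simps fps_X_mult_nth power_eq_if )
  ultimately show "fps_deriv (Abs_fps (\<lambda>n. - (c ^ n / of_nat n))) * (1 - fps_const c * fps_X) =
    fps_deriv (1 - fps_const c * fps_X)"
    by (simp add: mult.assoc)
qed auto

section \<open>The formal Borel transform\<close>

text \<open>
  \<open>t\<close> times the Borel transform: \<open>Z\<^sup>-\<^sup>n\<close> is the Laplace transform of \<open>t\<^bsup>n-1\<^esup> / (n - 1)!\<close>. The additional
  factor \<open>t\<close> is the one in the definition of \<open>\<Psi>\<close>.
\<close>
definition borel_fps :: "complex fps \<Rightarrow> complex fps" where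
  "borel_fps L = Abs_fps (\<lambda>n. if n = 0 then 0 else fps_nth L n / fact (n - 1))"

lemma shift_arg_power_nth:
  assumes "0 < i" "i \<le> n"
  shows "fps_nth (shift_arg r ^ i) n = of_nat ((n - 1) choose (i - 1)) * of_nat r ^ (n - i)"
proof -
  have "shift_arg r ^ i = fps_X ^ i * inverse ((1 - fps_const (of_nat r) * fps_X) ^ i)"
    by (simp add: shift_arg_def power_mult_distrib fps_inverse_power fps_of_nat)
  also have "fps_nth \<dots> n = of_nat ((i + (n - i) - 1) choose (n - i)) * of_nat r ^ (n - i)"
    using assms by (simp add: fps_X_power_mult_nth one_minus_const_fps_X_neg_power')
  also have "(i + (n - i) - 1) choose (n - i) = (n - 1) choose (i - 1)"
    using assms by (subst binomial_symmetric) auto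
  finally show ?thesis .
qed

text \<open>
  A shift of the variable of a Laplace transform is multiplication of the original by an
  exponential.
\<close>
lemma borel_fps_shift:
  "borel_fps (fps_compose L (shift_arg r)) = fps_exp (of_nat r) * borel_fps L"
proof (rule fps_ext)
  fix n
  show "fps_nth (borel_fps (fps_compose L (shift_arg r))) n =
        fps_nth (fps_exp (of_nat r) * borel_fps L) n"
  proof (cases "n = 0")
    case False
    have "fps_nth (fps_compose L (shift_arg r)) n / fact (n - 1) =
       (\<Sum>i=0..n. fps_nth L i * fps_nth (shift_arg r ^ i) n / fact (n - 1))"
      by (simp add: fps_compose_nth sum_divide_distrib)
    also have "\<dots> = (\<Sum>i=0..n. fps_nth (borel_fps L) i * fps_nth (fps_exp (of_nat r)) (n - i))"
    proof (rule sum.cong)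
      fix i assume i: "i \<in> {0..n}"
      show "fps_nth L i * fps_nth (shift_arg r ^ i) n / fact (n - 1) =
         fps_nth (borel_fps L) i * fps_nth (fps_exp (of_nat r)) (n - i)"
      proof (cases "i = 0")
        case True
        with False show ?thesis by (simp add: borel_fps_def)
      next
        case i0: False
        have "(of_nat ((n - 1) choose (i - 1)) :: complex) = fact (n - 1) / (fact (i - 1) * fact (n - i))"
          using i i0 by (subst binomial_fact) auto
        with i i0 show ?thesis
          by (simp add: shift_arg_power_nth borel_fps_def)
      qed
    qed simp
    finally show ?thesis
      using False by (simp add: borel_fps_def fps_mult_nth mult.commute[of "fps_exp _"])
  qed (simp add: borel_fps_def)
qed

lemma borel_fps_log_linear:
  "borel_fps (fps_log (1 - fps_const c * fps_X)) = 1 - fps_exp c"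
proof (rule fps_ext)
  fix n
  show "fps_nth (borel_fps (fps_log (1 - fps_const c * fps_X))) n = fps_nth (1 - fps_exp c) n"
    by (cases n) (simp_all add: borel_fps_def fps_log_linear distrib_right)
qed

section \<open>The shift equation\<close>

text \<open>
  The Mellin transform of \<open>K\<^sub>\<nu>(a z) K\<^sub>\<nu>(b z)\<close>, done formally. On series in \<open>X = 1 / z\<close>, the operator
  \<open>- z d/dz\<close> acts on \<open>f\<close> as \<open>\<partial>\<^sub>a f = X f' + (a / X + 1/2) f\<close>, if \<open>f\<close> stands for
  \<open>z\<^bsup>-1/2\<^esup> exp (- a z) f\<close>, and the differential equation becomes \<open>\<partial>\<^sub>a\<^sup>2 f = (a\<^sup>2 / X\<^sup>2 + \<nu>\<^sup>2) f\<close>.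
  The hypotheses on \<open>a\<close> and \<open>b\<close> have two effects. As \<open>a + b = 1\<close>, the operator on products is
  \<open>P u = X u' + (1 / X + 1) u\<close>, which does not involve \<open>a\<close> and \<open>b\<close>. And \<open>a\<^sup>2 + b\<^sup>2 = 0\<close>, so that
  with \<open>w = f \<partial>\<^sub>b g - \<partial>\<^sub>a f g\<close> one gets for \<open>u = f g\<close>
  \<open>(P\<^sup>2 - 4 \<nu>\<^sup>2) P u = 2 a\<^sup>2 X\<^sup>-\<^sup>2 w\<close> and \<open>P w = - 2 a\<^sup>2 X\<^sup>-\<^sup>2 u\<close>.
  Since \<open>a\<^sup>4 = - 1/4\<close>, eliminating \<open>w\<close> gives \<open>(P + 2) P (P\<^sup>2 - 4 \<nu>\<^sup>2) u = X\<^sup>-\<^sup>4 u\<close>.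

  Passing from \<open>u\<close> to \<open>X\<^sup>4 u\<close> turns \<open>P\<close> into \<open>T - 3\<close>, with \<open>T\<close> the operator that corresponds to
  multiplication by \<open>Z\<close>. So \<open>(Z - 1) (Z - 3) ((Z - 3)\<^sup>2 - 4 \<nu>\<^sup>2) \<Phi>(X\<^sup>4 u) = \<Phi>(u)\<close>, where the power of
  \<open>X\<close> leaves room for four applications of \<open>T\<close>.
\<close>
lemma hankel_product_recurrence:
  fixes f g :: "complex fps"
  assumes ab: "a + b = 1" "2 * a * b = 1"
  assumes f: "fps_X\<^sup>2 * fps_deriv (fps_deriv f) =
    - (2 * (fps_X + fps_const a) * fps_deriv f) - fps_const (1/4 - \<nu>\<^sup>2) * f"
  assumes g: "fps_X\<^sup>2 * fps_deriv (fps_deriv g) =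
    - (2 * (fps_X + fps_const b) * fps_deriv g) - fps_const (1/4 - \<nu>\<^sup>2) * g"
  shows "(1 - fps_X) * (1 - 3 * fps_X) * ((1 - 3 * fps_X)\<^sup>2 - 4 * fps_const (\<nu>\<^sup>2) * fps_X\<^sup>2) *
           inverse_factorial_series (fps_X ^ 4 * (f * g)) =
         fps_X ^ 4 * inverse_factorial_series (f * g)"
proof -
  define X :: "complex fps" where "X = fps_X"
  define \<a> where "\<a> = fps_const a"
  define \<b> where "\<b> = fps_const b"
  define N where "N = fps_const (\<nu>\<^sup>2)"
  define h :: "complex fps" where "h = fps_const (1/2)"
  have h: "2 * h = 1" by (simp add: h_def numeral_fps_const)
  have ab': "\<a> + \<b> = 1" "2 * \<a> * \<b> = 1"
    using ab by (simp_all add: \<a>_def \<b>_def numeral_fps_const)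
  have quarter: "fps_const (1/4 - \<nu>\<^sup>2) = h * h - N"
    by (simp add: h_def N_def)
  \<comment> \<open>\<open>f1 = X \<partial>\<^sub>a f\<close> and \<open>g1 = X \<partial>\<^sub>b g\<close>\<close>
  define f1 where "f1 = \<a> * f + h * X * f + X\<^sup>2 * fps_deriv f"
  define g1 where "g1 = \<b> * g + h * X * g + X\<^sup>2 * fps_deriv g"
  have dX: "fps_deriv X = 1" "fps_deriv h = 0" "fps_deriv \<a> = 0" "fps_deriv \<b> = 0" "fps_deriv N = 0"
    by (simp_all add: X_def h_def \<a>_def \<b>_def N_def)
  note f' = f[folded X_def \<a>_def, unfolded quarter]
  note g' = g[folded X_def \<b>_def, unfolded quarter]
  \<comment> \<open>The quantities \<open>\<kappa>\<close>, \<open>\<gamma>\<close>, \<open>q\<close> and \<open>zf\<close>, \<open>zg\<close>, \<open>zf1\<close>, \<open>zg1\<close> below all vanish. Each equation that follows is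
    proved by an explicit combination of them, which leaves a plain polynomial identity.\<close>
  define \<kappa> where "\<kappa> = 2 * h - 1"
  define \<gamma> where "\<gamma> = \<a> + \<b> - 1"
  define q where "q = \<a>\<^sup>2 + \<b>\<^sup>2"
  have z: "\<kappa> = 0" "\<gamma> = 0"
    using h ab' by (simp_all add: \<kappa>_def \<gamma>_def)
  have b: "\<b> = 1 - \<a>" using ab'(1) by (simp add: algebra_simps)
  have a2: "2 * \<a>\<^sup>2 = 2 * \<a> - 1"
    using ab'(2) unfolding b by (simp add: algebra_simps power2_eq_square)
  have q: "q = 0"
    using a2 unfolding q_def b by (simp add: algebra_simps power2_eq_square)
  have a4: "1 + 4 * \<a> ^ 4 = 0"
  proof -
    have "1 + 4 * \<a> ^ 4 = 1 + (2 * \<a>\<^sup>2)\<^sup>2" by (simp add: power_mult_distrib)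
    also have "\<dots> = 2 + 2 * (2 * \<a>\<^sup>2) - 4 * \<a>" unfolding a2 by (subst power2_diff) (simp add: power_mult_distrib a2[symmetric])
    also have "\<dots> = 0" unfolding a2 by simp
    finally show ?thesis .
  qed
  define zf where "zf = X\<^sup>2 * fps_deriv f - (f1 - \<a> * f - h * X * f)"
  define zg where "zg = X\<^sup>2 * fps_deriv g - (g1 - \<b> * g - h * X * g)"
  define zf1 where "zf1 = X\<^sup>2 * fps_deriv f1 - (h * X * f1 + (\<a>\<^sup>2 + N * X\<^sup>2) * f - \<a> * f1)"
  define zg1 where "zg1 = X\<^sup>2 * fps_deriv g1 - (h * X * g1 + (\<b>\<^sup>2 + N * X\<^sup>2) * g - \<b> * g1)"
  have zf: "zf = 0" and zg: "zg = 0"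
    by (simp_all add: zf_def zg_def f1_def g1_def)
  have zf1: "zf1 = 0"
  proof -
    have "zf1 = X\<^sup>2 * (X\<^sup>2 * fps_deriv (fps_deriv f) -
        (- (2 * (X + \<a>) * fps_deriv f) - (h * h - N) * f)) - \<kappa> * h * X\<^sup>2 * f"
      unfolding zf1_def f1_def \<kappa>_def by (simp add: dX power2_eq_square) algebra
    then show ?thesis by (simp only: f' z) simp
  qed
  have zg1: "zg1 = 0"
  proof -
    have "zg1 = X\<^sup>2 * (X\<^sup>2 * fps_deriv (fps_deriv g) -
        (- (2 * (X + \<b>) * fps_deriv g) - (h * h - N) * g)) - \<kappa> * h * X\<^sup>2 * g"
      unfolding zg1_def g1_def \<kappa>_def by (simp add: dX power2_eq_square) algebra
    then show ?thesis by (simp only: g' z) simp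
  qed
  let ?\<Phi> = inverse_factorial_series
  \<comment> \<open>The elements \<open>X\<^sup>4 u\<close>, \<open>X\<^sup>4 P u\<close>, \<open>X\<^sup>4 P\<^sup>2 u\<close> and \<open>X\<^sup>4 (P\<^sup>2 - 4 \<nu>\<^sup>2) P u\<close> for \<open>u = f g\<close>\<close>
  define h0 where "h0 = X ^ 4 * (f * g)"
  define h1 where "h1 = X ^ 3 * (f1 * g + f * g1)"
  define h2 where "h2 = X\<^sup>2 * (2 * N * X\<^sup>2 * (f * g) + 2 * (f1 * g1))"
  define h3 where "h3 = 2 * \<a>\<^sup>2 * X * (f * g1 - f1 * g)"
  have e1: "X * h1 = h0 + X\<^sup>2 * fps_deriv h0 - 3 * X * h0"
  proof -
    have d: "fps_deriv h0 = 4 * X ^ 3 * (f * g) + X ^ 4 * (fps_deriv f * g + f * fps_deriv g)"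
      unfolding h0_def by (simp add: dX power3_eq_cube power4_eq_xxxx algebra_simps)
    have "X * h1 - (h0 + X\<^sup>2 * fps_deriv h0 - 3 * X * h0) =
            X ^ 4 * (f * g) * (\<gamma> + \<kappa> * X) - X ^ 4 * (zf * g + f * zg)"
      unfolding d unfolding h0_def h1_def zf_def zg_def \<kappa>_def \<gamma>_def by algebra
    then show ?thesis by (simp add: z zf zg)
  qed
  have e2: "X * h2 = h1 + X\<^sup>2 * fps_deriv h1 - 3 * X * h1"
  proof -
    have d: "fps_deriv h1 = 3 * X\<^sup>2 * (f1 * g + f * g1) +
        X ^ 3 * (fps_deriv f1 * g + f1 * fps_deriv g + fps_deriv f * g1 + f * fps_deriv g1)"
      unfolding h1_def by (simp add: dX power2_eq_square power3_eq_cube algebra_simps)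
    have "X * h2 - (h1 + X\<^sup>2 * fps_deriv h1 - 3 * X * h1) =
            X ^ 3 * (\<gamma> * (f1 * g + f * g1) - q * (f * g)) -
            X ^ 3 * (zf1 * g + f1 * zg + zf * g1 + f * zg1)"
      unfolding d unfolding h1_def h2_def zf_def zg_def zf1_def zg1_def \<gamma>_def q_def by algebra
    then show ?thesis by (simp add: z q zf zg zf1 zg1)
  qed
  have e3: "X * h3 = (h2 - 4 * N * h0) + X\<^sup>2 * fps_deriv (h2 - 4 * N * h0) - 3 * X * (h2 - 4 * N * h0)"
  proof -
    define y where "y = 2 * (f1 * g1) - 2 * N * X\<^sup>2 * (f * g)"
    have y: "h2 - 4 * N * h0 = X\<^sup>2 * y"
      unfolding h0_def h2_def y_def by algebra
    have dy: "fps_deriv y = 2 * (fps_deriv f1 * g1 + f1 * fps_deriv g1) - 4 * N * X * (f * g)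
        - 2 * N * X\<^sup>2 * (fps_deriv f * g + f * fps_deriv g)"
      unfolding y_def by (simp add: dX power2_eq_square algebra_simps)
    have d: "fps_deriv (X\<^sup>2 * y) = 2 * X * y + X\<^sup>2 * fps_deriv y"
      by (simp add: dX power2_eq_square algebra_simps)
    have "X * h3 - (X\<^sup>2 * y + X\<^sup>2 * fps_deriv (X\<^sup>2 * y) - 3 * X * (X\<^sup>2 * y)) =
            X\<^sup>2 * (- 2 * q * (f1 * g) - 2 * (X * \<kappa> - \<gamma>) * (f1 * g1)
              - 2 * N * X\<^sup>2 * (\<gamma> + X * \<kappa>) * (f * g)) -
            X\<^sup>2 * (2 * (zf1 * g1 + f1 * zg1) - 2 * N * X\<^sup>2 * (zf * g + f * zg))"
      unfolding d dy unfolding y_def h3_def zf_def zg_def zf1_def zg1_def \<gamma>_def \<kappa>_def q_def by algebra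
    then show ?thesis unfolding y by (simp add: z q zf zg zf1 zg1)
  qed
  have e4: "X * (f * g) = h3 + X\<^sup>2 * fps_deriv h3 - 1 * X * h3"
  proof -
    have d: "fps_deriv h3 = 2 * \<a>\<^sup>2 * (f * g1 - f1 * g) + 2 * \<a>\<^sup>2 * X *
        (fps_deriv f * g1 + f * fps_deriv g1 - fps_deriv f1 * g - f1 * fps_deriv g)"
      unfolding h3_def by (simp add: dX power2_eq_square algebra_simps)
    have "X * (f * g) - (h3 + X\<^sup>2 * fps_deriv h3 - 1 * X * h3) =
            X * (f * g) * (1 + 4 * \<a> ^ 4) + 2 * \<a>\<^sup>2 * X * (\<gamma> * (f * g1 - f1 * g) - q * (f * g))
            - 2 * \<a>\<^sup>2 * X * (zf * g1 + f * zg1 - zf1 * g - f1 * zg)"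
      unfolding d unfolding h3_def zf_def zg_def zf1_def zg1_def \<gamma>_def q_def by algebra
    then show ?thesis by (simp add: z q zf zg zf1 zg1 a4)
  qed
  note \<Phi> = inverse_factorial_series_euler[folded X_def]
  have 3: "fps_const 3 = (3 :: complex fps)" "fps_const 1 = (1 :: complex fps)"
    by (simp_all add: numeral_fps_const)
  have p1: "(1 - 3 * X) * ?\<Phi> h0 = X * ?\<Phi> h1"
    using \<Phi>[of h1 h0 3] e1 by (simp add: 3)
  have p2: "(1 - 3 * X) * ?\<Phi> h1 = X * ?\<Phi> h2"
    using \<Phi>[of h2 h1 3] e2 by (simp add: 3)
  have p3: "(1 - 3 * X) * ?\<Phi> (h2 - 4 * N * h0) = X * ?\<Phi> h3"
    using \<Phi>[of h3 "h2 - 4 * N * h0" 3] e3 by (simp add: 3)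
  have p4: "(1 - X) * ?\<Phi> h3 = X * ?\<Phi> (f * g)"
    using \<Phi>[of "f * g" h3 1] e4 by simp
  have lin: "?\<Phi> (h2 - 4 * N * h0) = ?\<Phi> h2 - 4 * N * ?\<Phi> h0"
  proof -
    have "4 * N = fps_const (4 * \<nu>\<^sup>2)"
      by (simp add: N_def numeral_fps_const)
    then show ?thesis
      by (simp only:) (rule fps_ext, simp add: inverse_factorial_series_def algebra_simps
            sum_subtractf sum_distrib_left)
  qed
  have "(1 - X) * (1 - 3 * X) * ((1 - 3 * X)\<^sup>2 - 4 * N * X\<^sup>2) * ?\<Phi> h0 - X ^ 4 * ?\<Phi> (f * g) =
      (1 - X) * (1 - 3 * X) * ((1 - 3 * X) * ((1 - 3 * X) * ?\<Phi> h0 - X * ?\<Phi> h1) +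
        X * ((1 - 3 * X) * ?\<Phi> h1 - X * ?\<Phi> h2)) +
      (1 - X) * X\<^sup>2 * ((1 - 3 * X) * (?\<Phi> h2 - 4 * N * ?\<Phi> h0) - X * ?\<Phi> h3) +
      X ^ 3 * ((1 - X) * ?\<Phi> h3 - X * ?\<Phi> (f * g))"
    by algebra
  also have "\<dots> = 0"
    by (simp add: p1 p2 p3[unfolded lin] p4)
  finally show ?thesis
    by (simp add: h0_def X_def N_def)
qed

text \<open>
  \<open>F(Z) = ((Z - 3)\<^sup>2 - 4 \<alpha>\<^sup>2) / ((Z - 2) (Z - 4)) F(Z - 4)\<close>. Here \<open>\<Phi>(X\<^sup>4 u)\<close> is known in two ways, through
  the differential equation and as \<open>F(Z - 4) / ((Z - 1) (Z - 2) (Z - 3) (Z - 4))\<close>. The differential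
  equation is used with \<open>a = 1 / p\<close> and \<open>b = 1 / q\<close>.
\<close>
lemma F_series_shift_equation:
  fixes \<alpha> :: complex
  defines "F \<equiv> F_series \<alpha> \<alpha>"
  shows "(1 - 2 * fps_X) * (1 - 4 * fps_X) * F =
    (1 - fps_const (3 + 2 * \<alpha>) * fps_X) * (1 - fps_const (3 - 2 * \<alpha>) * fps_X) *
      fps_compose F (shift_arg 4)"
proof -
  let ?X = "fps_X :: complex fps"
  define u where "u = hankel_fps \<alpha> (1 + \<i>) * hankel_fps \<alpha> (1 - \<i>)"
  define V where "V = inverse_factorial_series (?X ^ 4 * u)"
  define W where "W = fps_compose F (shift_arg 4)"
  have F: "F = inverse_factorial_series u"
    by (simp add: F_def F_series_eq u_def)
  have "(1 - \<i>) / 2 + (1 + \<i>) / 2 = 1" "2 * ((1 - \<i>) / 2) * ((1 + \<i>) / 2) = 1"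
       "(1 - \<i>) / 2 * (1 + \<i>) = 1" "(1 + \<i>) / 2 * (1 - \<i>) = 1"
    by (simp_all add: field_simps)
  note ab = this
  have 1: "(1 - ?X) * (1 - 3 * ?X) * ((1 - 3 * ?X)\<^sup>2 - 4 * fps_const (\<alpha>\<^sup>2) * ?X\<^sup>2) * V = ?X ^ 4 * F"
    unfolding F V_def u_def
    by (rule hankel_product_recurrence[OF ab(1,2) hankel_fps_ode[OF ab(3)] hankel_fps_ode[OF ab(4)]])
  have "(\<Prod>j=1..4. 1 - of_nat j * ?X) = (1 - ?X) * (1 - 2 * ?X) * (1 - 3 * ?X) * (1 - 4 * ?X)"
    by (simp add: numeral_eq_Suc mult_ac)
  then have 2: "V * ((1 - ?X) * (1 - 2 * ?X) * (1 - 3 * ?X) * (1 - 4 * ?X)) = ?X ^ 4 * W"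
    using inverse_factorial_series_shift[of 4 u] by (simp only: V_def W_def F)
  let ?Q = "(1 - 3 * ?X)\<^sup>2 - 4 * fps_const (\<alpha>\<^sup>2) * ?X\<^sup>2"
  have "?X ^ 4 * ((1 - 2 * ?X) * (1 - 4 * ?X) * F) = (1 - 2 * ?X) * (1 - 4 * ?X) * (?X ^ 4 * F)"
    by (simp only: mult_ac)
  also have "\<dots> = ?Q * (V * ((1 - ?X) * (1 - 2 * ?X) * (1 - 3 * ?X) * (1 - 4 * ?X)))"
    unfolding 1 [symmetric] by (simp only: mult_ac)
  also have "\<dots> = ?X ^ 4 * (?Q * W)"
    unfolding 2 by (simp only: mult_ac)
  finally have "(1 - 2 * ?X) * (1 - 4 * ?X) * F = ?Q * W"
    by simp
  also have "?Q = (1 - fps_const (3 + 2 * \<alpha>) * ?X) * (1 - fps_const (3 - 2 * \<alpha>) * ?X)"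
  proof -
    have c: "fps_const (3 + 2 * \<alpha>) = 3 + 2 * fps_const \<alpha>" "fps_const (3 - 2 * \<alpha>) = 3 - 2 * fps_const \<alpha>"
      "fps_const (\<alpha>\<^sup>2) = (fps_const \<alpha>)\<^sup>2"
      by (simp_all add: numeral_fps_const fps_const_power)
    show ?thesis unfolding c by algebra
  qed
  finally show ?thesis by (simp only: W_def)
qed

text \<open>
  The shift equation is first order, and the transform turns it into a linear equation without
  shifts: the term of \<open>F(Z - 4)\<close> is \<open>e\<^bsup>4t\<^esup>\<close> times that of \<open>F(Z)\<close>, and the linear factors contribute
  one exponential each.
\<close>
lemma borel_fps_log_F_series:
  "borel_fps (fps_log (F_series \<alpha> \<alpha>)) * (fps_exp 4 - 1) =
     fps_exp (3 + 2 * \<alpha>) + fps_exp (3 - 2 * \<alpha>) - fps_exp 2 - fps_exp 4"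
proof -
  let ?F = "F_series \<alpha> \<alpha>"
  let ?l = "\<lambda>c. 1 - fps_const c * fps_X :: complex fps"
  let ?B = "\<lambda>f. borel_fps (fps_log f)"
  have add: "borel_fps (L + M) = borel_fps L + borel_fps M" for L M
    by (rule fps_ext) (simp add: borel_fps_def add_divide_distrib)
  have [simp]: "fps_nth ?F 0 = 1" by (rule F_series_nth_0)
  have "?l 2 * ?l 4 * ?F = ?l (3 + 2 * \<alpha>) * ?l (3 - 2 * \<alpha>) * fps_compose ?F (shift_arg 4)"
    using F_series_shift_equation[of \<alpha>] by (simp only: numeral_fps_const)
  then have "?B (?l 2 * ?l 4 * ?F) = ?B (?l (3 + 2 * \<alpha>) * ?l (3 - 2 * \<alpha>) * fps_compose ?F (shift_arg 4))"
    by (simp only:)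
  moreover have mult: "?B (f * g * h) = ?B f + ?B g + ?B h"
    if "fps_nth f 0 = 1" "fps_nth g 0 = 1" "fps_nth h 0 = 1" for f g h
    using that by (simp add: fps_log_mult add)
  have "?B (?l 2 * ?l 4 * ?F) = ?B (?l 2) + ?B (?l 4) + ?B ?F"
    by (rule mult) simp_all
  moreover have "?B (?l (3 + 2 * \<alpha>) * ?l (3 - 2 * \<alpha>) * fps_compose ?F (shift_arg 4)) =
      ?B (?l (3 + 2 * \<alpha>)) + ?B (?l (3 - 2 * \<alpha>)) + ?B (fps_compose ?F (shift_arg 4))"
    by (rule mult) simp_all
  moreover have "?B (fps_compose ?F (shift_arg 4)) = fps_exp 4 * ?B ?F"
    by (simp add: fps_log_compose borel_fps_shift)
  ultimately have "?B (?l 2) + ?B (?l 4) + ?B ?F =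
      ?B (?l (3 + 2 * \<alpha>)) + ?B (?l (3 - 2 * \<alpha>)) + fps_exp 4 * ?B ?F"
    by (simp only:)
  then show ?thesis
    unfolding borel_fps_log_linear by (simp add: algebra_simps)
qed

section \<open>The closed forms\<close>

lemma Psi_eq_borel_fps: "Psi (\<alpha>\<^sup>2) = borel_fps (fps_log (F_series \<alpha> \<alpha>))"
  by (rule fps_ext) (simp add: Psi_def borel_fps_def L_diag_square L_coeff_def)

lemma bernoulli_poly_fps:
  "Abs_fps (\<lambda>n. bernoulli_poly n x / fact n) * (fps_exp 1 - 1) = fps_X * fps_exp x"
proof -
  have E: "subdegree (fps_exp 1 - 1 :: complex fps) = 1"
    by (rule subdegreeI) auto
  have nz: "fps_exp 1 - 1 \<noteq> (0 :: complex fps)"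
    using E by auto
  have "(fps_exp 1 - 1) dvd (fps_X * fps_exp x :: complex fps)"
    by (subst fps_dvd_iff) (use E nz in auto)
  moreover have "Abs_fps (\<lambda>n. bernoulli_poly n x / fact n) = fps_X * fps_exp x / (fps_exp 1 - 1)"
    by (rule fps_ext) (simp add: bernoulli_poly_def)
  ultimately show ?thesis by simp
qed

lemma bernoulli_poly_fps_scaled:
  "Abs_fps (\<lambda>n. c ^ n * bernoulli_poly n x / fact n) * (fps_exp c - 1) =
     fps_const c * fps_X * fps_exp (c * x)"
proof -
  let ?b = "Abs_fps (\<lambda>n. bernoulli_poly n x / fact n)"
  have "Abs_fps (\<lambda>n. c ^ n * bernoulli_poly n x / fact n) = fps_compose ?b (fps_const c * fps_X)"
    by (simp add: fps_compose_linear)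
  moreover have "fps_compose (?b * (fps_exp 1 - 1)) (fps_const c * fps_X) =
        fps_compose (fps_X * fps_exp x) (fps_const c * fps_X)"
    by (simp only: bernoulli_poly_fps)
  ultimately show ?thesis
    by (simp add: fps_compose_mult_distrib fps_compose_sub_distrib)
qed

text \<open>
  The exponents satisfy \<open>3 \<plusminus> 2 \<alpha> = 4 \<cdot> (3 \<plusminus> 2 \<alpha>) / 4\<close>, \<open>4 = 4 \<cdot> 1\<close> and \<open>2 = 4 \<cdot> 1/2\<close>. So \<open>4 t \<Psi>(t)\<close> is a
  combination of the Bernoulli generating functions \<open>4 t e\<^bsup>4xt\<^esup> / (e\<^bsup>4t\<^esup> - 1)\<close>. The factor \<open>t\<close> is the reason
  why the Bernoulli polynomials have index \<open>n + 1\<close>.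
\<close>
lemma L_coeff_diag_eq_bernoulli:
  assumes "n \<ge> 1"
  shows "L_coeff \<alpha> \<alpha> n =
           4 ^ n / (of_nat n * (of_nat n + 1)) *
             (bernoulli_poly (n + 1) ((3 + 2 * \<alpha>) / 4)
              + bernoulli_poly (n + 1) ((3 - 2 * \<alpha>) / 4)
              - bernoulli_poly (n + 1) 1
              - bernoulli_poly (n + 1) (1 / 2))"
proof -
  let ?L = "fps_log (F_series \<alpha> \<alpha>)"
  define b where "b = (\<lambda>x. Abs_fps (\<lambda>n. 4 ^ n * bernoulli_poly n x / fact n))"
  have b: "b x * (fps_exp 4 - 1) = fps_const 4 * fps_X * fps_exp (4 * x)" for x
    unfolding b_def by (rule bernoulli_poly_fps_scaled)
  let ?x = "(3 + 2 * \<alpha>) / 4" and ?y = "(3 - 2 * \<alpha>) / 4"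
  have "(b ?x + b ?y - b 1 - b (1/2)) * (fps_exp 4 - 1) =
        fps_const 4 * fps_X * (borel_fps ?L * (fps_exp 4 - 1))"
    unfolding borel_fps_log_F_series
    unfolding left_diff_distrib distrib_right b
    by (simp add: right_diff_distrib distrib_left mult.assoc add_divide_distrib diff_divide_distrib)
  then have "(b ?x + b ?y - b 1 - b (1/2)) * (fps_exp 4 - 1) =
        (fps_const 4 * fps_X * borel_fps ?L) * (fps_exp 4 - 1)"
    by (simp only: mult.assoc)
  moreover have "fps_nth (fps_exp 4 - 1 :: complex fps) 1 \<noteq> 0"
    by simp
  then have "fps_exp 4 - 1 \<noteq> (0 :: complex fps)"
    by (metis fps_zero_nth)
  ultimately have "b ?x + b ?y - b 1 - b (1/2) = fps_const 4 * fps_X * borel_fps ?L"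
    by (simp only: mult_cancel_right) blast
  from arg_cong[OF this, of "\<lambda>f. fps_nth f (Suc n)"]
  have "4 ^ Suc n * (bernoulli_poly (Suc n) ?x + bernoulli_poly (Suc n) ?y
          - bernoulli_poly (Suc n) 1 - bernoulli_poly (Suc n) (1/2)) / fact (Suc n) =
        4 * L_coeff \<alpha> \<alpha> n / fact (n - 1)" (is "4 ^ Suc n * ?S / _ = _")
    using assms
    by (simp add: b_def borel_fps_def L_coeff_def mult.assoc diff_divide_distrib add_divide_distrib
        right_diff_distrib distrib_left del: power_Suc fact_Suc)
  moreover have "fact (Suc n) = (of_nat n * (of_nat n + 1) * fact (n - 1) :: complex)"
    using assms by (cases n) (simp_all add: algebra_simps)
  moreover have "of_nat n \<noteq> (0 :: complex)" "of_nat n + 1 \<noteq> (0 :: complex)"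
    using assms by (simp_all add: of_nat_Suc [symmetric] add.commute del: of_nat_Suc)
  moreover have "S = N * M * L / c" if "4 * c * S / (N * M * f) = 4 * L / f" "f \<noteq> 0" "c \<noteq> 0" "N \<noteq> 0" "M \<noteq> 0"
    for S N M L c f :: complex
    using that by (simp add: field_simps)
  ultimately have "?S = of_nat n * (of_nat n + 1) * L_coeff \<alpha> \<alpha> n / 4 ^ n"
    by simp
  with \<open>of_nat n \<noteq> 0\<close> \<open>of_nat n + 1 \<noteq> 0\<close> have "L_coeff \<alpha> \<alpha> n = 4 ^ n / (of_nat n * (of_nat n + 1)) * ?S"
    by (simp only:) simp
  then show ?thesis by simp
qed

lemma fls_exp_add: "fls_exp (a + b) = fls_exp a * fls_exp b"
  by (simp add: fls_exp_def fps_exp_add_mult fls_times_fps_to_fls)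

text \<open>
  With \<open>x = e\<^sup>t\<close>, all functions involved are rational in \<open>x\<close> and \<open>e\<^bsup>\<plusminus>2\<alpha>t\<^esup>\<close>, and the denominators divide a
  power of \<open>x\<close> times \<open>x\<^sup>4 - 1\<close>.
\<close>
lemma Psi_closed_forms:
  shows "fps_to_fls (Psi (\<alpha>\<^sup>2)) =
           fls_exp 1 * (fls_cosh (2 * \<alpha>) - fls_cosh 1) / fls_sinh 2" (is ?A)
    and "fps_to_fls (Psi (\<alpha>\<^sup>2)) =
           1 / 2 * (1 / fls_sinh 1 + 1 / fls_cosh 1) * (fls_cosh (2 * \<alpha>) - fls_cosh 1)" (is ?B)
proof -
  define P where "P = fps_to_fls (Psi (\<alpha>\<^sup>2))"
  define x where "x = fls_exp 1"
  define y where "y = fls_exp (2 * \<alpha>)"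
  define z where "z = fls_exp (- (2 * \<alpha>))"
  have exp_0: "fls_exp 0 = 1" by (simp add: fls_exp_def)
  have exp_nz: "fls_exp c \<noteq> 0" for c
    using fls_exp_add[of c "- c"] exp_0 by auto
  have x0: "x \<noteq> 0" by (simp add: x_def exp_nz)
  have e2: "fls_exp 2 = x\<^sup>2"
    using fls_exp_add[of 1 1] by (simp add: x_def power2_eq_square)
  have e4: "fls_exp 4 = x ^ 4"
    using fls_exp_add[of 2 2] by (simp add: e2)
  have e3: "fls_exp 3 = x ^ 3"
    using fls_exp_add[of 2 1] by (simp add: e2 x_def power3_eq_cube power2_eq_square)
  have inv: "fls_exp (- c) = 1 / fls_exp c" for c
    using fls_exp_add[of c "- c"] exp_0 exp_nz[of c] by (simp add: field_simps)
  have e31: "fls_exp (3 + 2 * \<alpha>) = x ^ 3 * y" "fls_exp (3 - 2 * \<alpha>) = x ^ 3 * z"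
    using fls_exp_add[of 3 "2 * \<alpha>"] fls_exp_add[of 3 "- (2 * \<alpha>)"] by (simp_all add: e3 y_def z_def)
  have "fps_to_fls (Psi (\<alpha>\<^sup>2) * (fps_exp 4 - 1)) =
        fps_to_fls (fps_exp (3 + 2 * \<alpha>) + fps_exp (3 - 2 * \<alpha>) - fps_exp 2 - fps_exp 4)"
    by (simp only: Psi_eq_borel_fps borel_fps_log_F_series)
  then have P: "P * (x ^ 4 - 1) = x ^ 3 * y + x ^ 3 * z - x\<^sup>2 - x ^ 4"
    by (simp add: fls_times_fps_to_fls P_def flip: fls_exp_def e4 e31 e2)
  have "fps_nth (fps_exp 4 - 1 :: complex fps) 1 \<noteq> 0"
    by simp
  then have "fps_exp 4 - 1 \<noteq> (0 :: complex fps)"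
    by (metis fps_zero_nth)
  then have "fps_to_fls (fps_exp 4 - 1 :: complex fps) \<noteq> 0"
    by (simp only: fps_to_fls_eq_0_iff not_False_eq_True)
  then have x4: "x ^ 4 - 1 \<noteq> 0"
    by (simp flip: fls_exp_def e4)
  have "x ^ 4 - 1 = (x\<^sup>2 - 1) * (x\<^sup>2 + 1)"
    by (simp add: power2_eq_square power4_eq_xxxx algebra_simps)
  with x4 have x2: "x\<^sup>2 - 1 \<noteq> 0" "x\<^sup>2 + 1 \<noteq> 0" by auto
  have s2: "fls_sinh 2 = (x ^ 4 - 1) / (2 * x\<^sup>2)"
    using x0 by (simp add: fls_sinh_def inv e2 divide_simps)
  have s1: "fls_sinh 1 = (x\<^sup>2 - 1) / (2 * x)" and c1: "fls_cosh 1 = (x\<^sup>2 + 1) / (2 * x)"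
    using x0 by (simp_all add: fls_sinh_def fls_cosh_def inv flip: x_def) (simp_all add: field_simps power2_eq_square)
  have ca: "fls_cosh (2 * \<alpha>) = (y + z) / 2"
    by (simp add: fls_cosh_def y_def z_def)
  have main: "P = (x ^ 3 * y + x ^ 3 * z - x\<^sup>2 - x ^ 4) / (x ^ 4 - 1)"
    using P x4 by (simp add: eq_divide_eq)
  have R: "x ^ 3 * y + x ^ 3 * z - x\<^sup>2 - x ^ 4 = x\<^sup>2 * (x * (y + z) - (x\<^sup>2 + 1))"
    by (simp add: algebra_simps power2_eq_square power3_eq_cube power4_eq_xxxx)
  have D: "fls_cosh (2 * \<alpha>) - fls_cosh 1 = (x * (y + z) - (x\<^sup>2 + 1)) / (2 * x)"
    unfolding ca c1 using x0 by (simp add: field_simps)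
  define w where "w = x * (y + z) - (x\<^sup>2 + 1)"
  have A: "P = fls_exp 1 * (fls_cosh (2 * \<alpha>) - fls_cosh 1) / fls_sinh 2"
    unfolding main R D s2 x_def [symmetric] w_def [symmetric] using x0 x4
    by (simp add: field_simps)
  then show ?A by (simp only: P_def)
  have "1 / 2 * (1 / fls_sinh 1 + 1 / fls_cosh 1) = x / fls_sinh 2"
  proof -
    have f: "x ^ 4 - 1 = (x\<^sup>2 - 1) * (x\<^sup>2 + 1)" by fact
    show ?thesis
      unfolding s1 c1 s2 f using x0 x2
      by (simp add: divide_simps) (simp add: algebra_simps power2_eq_square)
  qed
  with A show ?B by (simp add: P_def x_def)
qed

theorem theorem1p1:
  fixes \<alpha> A :: complex
  assumes "A = \<alpha>\<^sup>2"
  shows "fps_to_fls (Psi A) =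
           fls_exp 1 * (fls_cosh (2 * \<alpha>) - fls_cosh 1) / fls_sinh 2 \<and>
         fps_to_fls (Psi A) =
           1 / 2 * (1 / fls_sinh 1 + 1 / fls_cosh 1) * (fls_cosh (2 * \<alpha>) - fls_cosh 1) \<and>
         (\<forall>n\<ge>1. L_coeff \<alpha> \<alpha> n =
           4 ^ n / (of_nat n * (of_nat n + 1)) *
             (bernoulli_poly (n + 1) ((3 + 2 * \<alpha>) / 4)
              + bernoulli_poly (n + 1) ((3 - 2 * \<alpha>) / 4)
              - bernoulli_poly (n + 1) 1
              - bernoulli_poly (n + 1) (1 / 2)))"
  using L_coeff_diag_eq_bernoulli Psi_closed_forms unfolding assms by blast

end
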